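(* Let $R$ be a Gelfand ring and let $\mathfrak{m}$ be a maximal ideal of $R$. Then $\mathfrak{m}$ is a pure ideal if and only if $\operatorname{Ker}\pi_{\mathfrak{m}}=\mathfrak{m}$.
   Context: All rings are commutative with identity. A ring $R$ is called a Gelfand ring (pm-ring) if every prime ideal of $R$ is contained in a unique maximal ideal. An ideal $I$ of $R$ is pure if the canonical homomorphism $R\to R/I$ is flat; equivalently, for each $a\in I$ there exists $b\in I$ with $a(1-b)=0$. For a prime ideal $\mathfrak{p}$, $\pi_{\mathfrak{p}}:R\to R_{\mathfrak{p}}=(R\setminus\mathfrak{p})^{-1}R$ denotes the natural localization homomorphism. *)

theory Defs
  imports "HOL-Algebra.Algebra"
begin

section \<open>Gelfand rings\<close>

locale gelfand_ring = cring R for R (structure) +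
  assumes unique_maximal: "primeideal p R \<Longrightarrow> \<exists>!m. maximalideal m R \<and> p \<subseteq> m"

section \<open>Localization\<close>

definition loc_rel :: "('a, 'x) ring_scheme \<Rightarrow> 'a set \<Rightarrow> (('a \<times> 'a) \<times> ('a \<times> 'a)) set" where
  "loc_rel R S =
    {((a, s), (b, t)) | a s b t. a \<in> carrier R \<and> b \<in> carrier R \<and> s \<in> S \<and> t \<in> S \<and>
       (\<exists>u \<in> S. u \<otimes>\<^bsub>R\<^esub> (a \<otimes>\<^bsub>R\<^esub> t \<ominus>\<^bsub>R\<^esub> b \<otimes>\<^bsub>R\<^esub> s) = \<zero>\<^bsub>R\<^esub>)}"

definition loc_frac :: "('a, 'x) ring_scheme \<Rightarrow> 'a set \<Rightarrow> 'a \<Rightarrow> 'a \<Rightarrow> ('a \<times> 'a) set" where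
  "loc_frac R S a s = loc_rel R S `` {(a, s)}"

definition localization :: "('a, 'x) ring_scheme \<Rightarrow> 'a set \<Rightarrow> ('a \<times> 'a) set ring" where
  "localization R S =
    \<lparr>carrier = (carrier R \<times> S) // loc_rel R S,
     monoid.mult = (\<lambda>P Q. \<Union>(a, s) \<in> P. \<Union>(b, t) \<in> Q. loc_frac R S (a \<otimes>\<^bsub>R\<^esub> b) (s \<otimes>\<^bsub>R\<^esub> t)),
     one = loc_frac R S \<one>\<^bsub>R\<^esub> \<one>\<^bsub>R\<^esub>,
     ring.zero = loc_frac R S \<zero>\<^bsub>R\<^esub> \<one>\<^bsub>R\<^esub>,
     ring.add = (\<lambda>P Q. \<Union>(a, s) \<in> P. \<Union>(b, t) \<in> Q.
              loc_frac R S (a \<otimes>\<^bsub>R\<^esub> t \<oplus>\<^bsub>R\<^esub> b \<otimes>\<^bsub>R\<^esub> s) (s \<otimes>\<^bsub>R\<^esub> t))\<rparr>"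

definition localization_at :: "('a, 'x) ring_scheme \<Rightarrow> 'a set \<Rightarrow> ('a \<times> 'a) set ring" where
  "localization_at R p = localization R (carrier R - p)"

definition localization_map :: "('a, 'x) ring_scheme \<Rightarrow> 'a set \<Rightarrow> 'a \<Rightarrow> ('a \<times> 'a) set" where
  "localization_map R p a = loc_frac R (carrier R - p) a \<one>\<^bsub>R\<^esub>"

section \<open>Tensor products and flatness\<close>

definition linear_maps ::
    "('a, 'x) ring_scheme \<Rightarrow> ('a, 'u) module \<Rightarrow> ('a, 'v) module \<Rightarrow> ('u \<Rightarrow> 'v) set" where
  "linear_maps R M N =
    {f \<in> carrier M \<rightarrow> carrier N.
       (\<forall>x \<in> carrier M. \<forall>y \<in> carrier M. f (x \<oplus>\<^bsub>M\<^esub> y) = f x \<oplus>\<^bsub>N\<^esub> f y) \<and>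
       (\<forall>r \<in> carrier R. \<forall>x \<in> carrier M. f (r \<odot>\<^bsub>M\<^esub> x) = r \<odot>\<^bsub>N\<^esub> f x)}"

abbreviation tensor_free :: "('a, 'u) module \<Rightarrow> ('a, 's) module \<Rightarrow> ('u \<times> 's \<Rightarrow>\<^sub>0 int) monoid" where
  "tensor_free M A \<equiv> free_Abelian_group (carrier M \<times> carrier A)"

definition tensor_gens ::
    "('a, 'x) ring_scheme \<Rightarrow> ('a, 'u) module \<Rightarrow> ('a, 's) module \<Rightarrow> ('u \<times> 's \<Rightarrow>\<^sub>0 int) set" where
  "tensor_gens R M A =
     {frag_of (x \<oplus>\<^bsub>M\<^esub> y, a) - frag_of (x, a) - frag_of (y, a) | x y a.
        x \<in> carrier M \<and> y \<in> carrier M \<and> a \<in> carrier A} \<union>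
     {frag_of (x, a \<oplus>\<^bsub>A\<^esub> b) - frag_of (x, a) - frag_of (x, b) | x a b.
        x \<in> carrier M \<and> a \<in> carrier A \<and> b \<in> carrier A} \<union>
     {frag_of (r \<odot>\<^bsub>M\<^esub> x, a) - frag_of (x, r \<odot>\<^bsub>A\<^esub> a) | r x a.
        r \<in> carrier R \<and> x \<in> carrier M \<and> a \<in> carrier A}"

definition tensor_rels ::
    "('a, 'x) ring_scheme \<Rightarrow> ('a, 'u) module \<Rightarrow> ('a, 's) module \<Rightarrow> ('u \<times> 's \<Rightarrow>\<^sub>0 int) set" where
  "tensor_rels R M A = generate (tensor_free M A) (tensor_gens R M A)"

text \<open>The tensor product over \<open>R\<close>, as an abelian group (in multiplicative notation); its
  \<open>R\<close>-module structure plays no role in the definition of flatness.\<close>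

definition tensor ::
    "('a, 'x) ring_scheme \<Rightarrow> ('a, 'u) module \<Rightarrow> ('a, 's) module \<Rightarrow> ('u \<times> 's \<Rightarrow>\<^sub>0 int) set monoid" where
  "tensor R M A = tensor_free M A Mod tensor_rels R M A"

text \<open>The map \<open>f \<otimes> id\<close> from \<open>M \<otimes> A\<close> to \<open>N \<otimes> A\<close>. The union over the representatives of a coset is a
  single coset, see \<open>tensor_map_coset\<close> below.\<close>

definition tensor_map ::
    "('a, 'x) ring_scheme \<Rightarrow> ('a, 'u) module \<Rightarrow> ('a, 'v) module \<Rightarrow> ('a, 's) module \<Rightarrow> ('u \<Rightarrow> 'v) \<Rightarrow>
      ('u \<times> 's \<Rightarrow>\<^sub>0 int) set \<Rightarrow> ('v \<times> 's \<Rightarrow>\<^sub>0 int) set" where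
  "tensor_map R M N A f P =
    (\<Union>u \<in> P. tensor_rels R N A #>\<^bsub>tensor_free N A\<^esub> frag_extend (\<lambda>(x, a). frag_of (f x, a)) u)"

text \<open>The argument of type \<open>'u itself\<close> is the type (universe) in which the test modules \<open>M\<close> and
  \<open>N\<close> have their carriers.\<close>

definition flat_module ::
    "'u itself \<Rightarrow> ('a, 'x) ring_scheme \<Rightarrow> ('a, 's) module \<Rightarrow> bool" where
  "flat_module U R A \<longleftrightarrow> module R A \<and>
    (\<forall>(M :: ('a, 'u) module) (N :: ('a, 'u) module) f.
       module R M \<and> module R N \<and> f \<in> linear_maps R M N \<and> inj_on f (carrier M) \<longrightarrow>
       inj_on (tensor_map R M N A f) (carrier (tensor R M A)))"

definition restrict_scalars ::
    "('b, 'y) ring_scheme \<Rightarrow> ('a \<Rightarrow> 'b) \<Rightarrow> ('a, 'b) module" where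
  "restrict_scalars S h =
    \<lparr>carrier = carrier S, monoid.mult = monoid.mult S, one = \<one>\<^bsub>S\<^esub>, ring.zero = \<zero>\<^bsub>S\<^esub>, ring.add = ring.add S,
     smult = (\<lambda>r s. h r \<otimes>\<^bsub>S\<^esub> s)\<rparr>"

definition flat_ring_hom ::
    "'u itself \<Rightarrow> ('a, 'x) ring_scheme \<Rightarrow> ('b, 'y) ring_scheme \<Rightarrow> ('a \<Rightarrow> 'b) \<Rightarrow> bool" where
  "flat_ring_hom U R S h \<longleftrightarrow> h \<in> ring_hom R S \<and> flat_module U R (restrict_scalars S h)"

section \<open>Pure ideals\<close>

text \<open>Taking the test modules in the type of \<open>R\<close> itself loses nothing: by \<open>pure_ideal_flat\<close> below,
  the canonical map is then flat with respect to test modules in every type.\<close>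

definition pure_ideal :: "'a set \<Rightarrow> ('a, 'x) ring_scheme \<Rightarrow> bool" where
  "pure_ideal I R \<longleftrightarrow> ideal I R \<and> flat_ring_hom TYPE('a) R (R Quot I) (\<lambda>r. I +>\<^bsub>R\<^esub> r)"

section \<open>Independence of the type of the test modules\<close>

lemma tensor_gens_subset:
  assumes "module R M" "module R A"
  shows "tensor_gens R M A \<subseteq> carrier (tensor_free M A)"
proof -
  interpret M: module R M by fact
  interpret A: module R A by fact
  have k: "u - v \<in> carrier (tensor_free M A)"
    if "u \<in> carrier (tensor_free M A)" "v \<in> carrier (tensor_free M A)" for u v
    using that unfolding carrier_free_Abelian_group_iff
    by (rule subset_trans[OF keys_diff Un_least])
  have o: "frag_of (x, a) \<in> carrier (tensor_free M A)" if "x \<in> carrier M" "a \<in> carrier A" for x a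
    using that by simp
  show ?thesis
  proof
    fix u assume "u \<in> tensor_gens R M A"
    then show "u \<in> carrier (tensor_free M A)"
      unfolding tensor_gens_def
      by (elim UnE CollectE exE conjE) (simp_all only: k o M.M.a_closed A.M.a_closed M.smult_closed A.smult_closed)
  qed
qed

lemma subgroup_tensor_rels:
  assumes "module R M" "module R A"
  shows "subgroup (tensor_rels R M A) (tensor_free M A)"
  unfolding tensor_rels_def
  using assms by (intro group.generate_is_subgroup tensor_gens_subset) auto

lemma tensor_rels_keys:
  assumes "module R M" "module R A" "u \<in> tensor_rels R M A"
  shows "Poly_Mapping.keys u \<subseteq> carrier M \<times> carrier A"
  using subsetD[OF subgroup.subset[OF subgroup_tensor_rels[OF assms(1,2)]] assms(3)]
  unfolding carrier_free_Abelian_group_iff .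

lemma tensor_rels_zero: "0 \<in> tensor_rels R M A"
  unfolding tensor_rels_def using generate.one[of "tensor_free M A"] by simp

lemma tensor_rels_add:
  "u \<in> tensor_rels R M A \<Longrightarrow> v \<in> tensor_rels R M A \<Longrightarrow> u + v \<in> tensor_rels R M A"
  unfolding tensor_rels_def using generate.eng[of _ "tensor_free M A"] by fastforce

lemma tensor_rels_minus:
  assumes "module R M" "module R A" "u \<in> tensor_rels R M A"
  shows "- u \<in> tensor_rels R M A"
  using subgroup.m_inv_closed[OF subgroup_tensor_rels[OF assms(1,2)] assms(3)]
    tensor_rels_keys[OF assms] by simp

lemma tensor_rels_diff:
  assumes "module R M" "module R A" "u \<in> tensor_rels R M A" "v \<in> tensor_rels R M A"
  shows "u - v \<in> tensor_rels R M A"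
  using tensor_rels_add[OF assms(3) tensor_rels_minus[OF assms(1,2,4)]] by simp

lemma tensor_gens_rels: "u \<in> tensor_gens R M A \<Longrightarrow> u \<in> tensor_rels R M A"
  unfolding tensor_rels_def by (rule generate.incl)

lemma tensor_coset_eq_iff:
  assumes "module R M" "module R A"
    and "u \<in> carrier (tensor_free M A)" "v \<in> carrier (tensor_free M A)"
  shows "tensor_rels R M A #>\<^bsub>tensor_free M A\<^esub> u = tensor_rels R M A #>\<^bsub>tensor_free M A\<^esub> v
    \<longleftrightarrow> u - v \<in> tensor_rels R M A" (is "?K #>\<^bsub>?F\<^esub> u = _ \<longleftrightarrow> _")
proof -
  interpret F: group ?F by simp
  note K = subgroup_tensor_rels[OF assms(1,2)]
  have "?K #>\<^bsub>?F\<^esub> u = ?K #>\<^bsub>?F\<^esub> v \<longleftrightarrow> u \<in> ?K #>\<^bsub>?F\<^esub> v"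
    using F.repr_independence[OF _ assms(4) K, of u] F.rcos_self[OF assms(3) K] by auto
  also have "\<dots> \<longleftrightarrow> u - v \<in> ?K"
    proof
    assume "u - v \<in> ?K"
    then show "u \<in> ?K #>\<^bsub>?F\<^esub> v"
      unfolding r_coset_def by (auto intro!: bexI[of _ "u - v"])
  qed (auto simp: r_coset_def)
  finally show ?thesis .
qed

lemma tensor_map_rels:
  assumes M: "module R M" and N: "module R N" and A: "module R A" and f: "f \<in> linear_maps R M N"
    and u: "u \<in> tensor_rels R M A"
  shows "frag_extend (\<lambda>(x, a). frag_of (f x, a)) u \<in> tensor_rels R N A"
proof -
  let ?e = "frag_extend (\<lambda>(x, a). frag_of (f x, a))"
  have g: "?e u \<in> tensor_rels R N A" if "u \<in> tensor_gens R M A" for u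
  proof -
    have *: "f x \<in> carrier N" if "x \<in> carrier M" for x
      using f that by (auto simp: linear_maps_def)
    have "?e u \<in> tensor_gens R N A"
      using that unfolding tensor_gens_def[of R M A]
    proof (elim UnE CollectE exE conjE)
      fix x y a assume "u = frag_of (x \<oplus>\<^bsub>M\<^esub> y, a) - frag_of (x, a) - frag_of (y, a)"
        and xy: "x \<in> carrier M" "y \<in> carrier M" "a \<in> carrier A"
      then have "?e u = frag_of (f x \<oplus>\<^bsub>N\<^esub> f y, a) - frag_of (f x, a) - frag_of (f y, a)"
        using f by (simp add: frag_extend_diff linear_maps_def)
      then show ?thesis unfolding tensor_gens_def using *[OF xy(1)] *[OF xy(2)] xy(3) by blast
    next
      fix x a b assume "u = frag_of (x, a \<oplus>\<^bsub>A\<^esub> b) - frag_of (x, a) - frag_of (x, b)"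
        and xy: "x \<in> carrier M" "a \<in> carrier A" "b \<in> carrier A"
      then have "?e u = frag_of (f x, a \<oplus>\<^bsub>A\<^esub> b) - frag_of (f x, a) - frag_of (f x, b)"
        by (simp add: frag_extend_diff)
      then show ?thesis unfolding tensor_gens_def using *[OF xy(1)] xy(2,3) by blast
    next
      fix r x a assume "u = frag_of (r \<odot>\<^bsub>M\<^esub> x, a) - frag_of (x, r \<odot>\<^bsub>A\<^esub> a)"
        and xy: "r \<in> carrier R" "x \<in> carrier M" "a \<in> carrier A"
      then have "?e u = frag_of (r \<odot>\<^bsub>N\<^esub> f x, a) - frag_of (f x, r \<odot>\<^bsub>A\<^esub> a)"
        using f by (simp add: frag_extend_diff linear_maps_def)
      then show ?thesis unfolding tensor_gens_def using *[OF xy(2)] xy(1,3) by blast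
    qed
    then show ?thesis by (rule tensor_gens_rels)
  qed
  show ?thesis
    using u unfolding tensor_rels_def[of R M A]
  proof (induction rule: generate.induct)
    case one then show ?case by (simp add: tensor_rels_zero)
  next
    case (incl h) then show ?case by (rule g)
  next
    case (inv h)
    have "inv\<^bsub>tensor_free M A\<^esub> h = - h"
      using tensor_gens_subset[OF M A] inv by (auto intro: inv_free_Abelian_group)
    then show ?case using tensor_rels_minus[OF N A g[OF inv]] by (simp add: frag_extend_minus)
  next
    case (eng h1 h2) then show ?case by (simp add: frag_extend_add tensor_rels_add)
  qed
qed

lemma tensor_map_closed:
  assumes f: "f \<in> linear_maps R M N" and u: "u \<in> carrier (tensor_free M A)"
  shows "frag_extend (\<lambda>(x, a). frag_of (f x, a)) u \<in> carrier (tensor_free N A)"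
proof -
  have "Poly_Mapping.keys (frag_extend (\<lambda>(x, a). frag_of (f x, a)) u) \<subseteq> (\<Union>(x, a) \<in> Poly_Mapping.keys u. {(f x, a)})"
    using keys_frag_extend[of "\<lambda>(x, a). frag_of (f x, a)" u] by (simp add: case_prod_beta)
  moreover have "Poly_Mapping.keys u \<subseteq> carrier M \<times> carrier A" "f ` carrier M \<subseteq> carrier N"
    using u f by (auto simp: linear_maps_def)
  ultimately show ?thesis
    unfolding carrier_free_Abelian_group_iff by blast
qed

lemma tensor_map_coset:
  assumes M: "module R M" and N: "module R N" and A: "module R A" and f: "f \<in> linear_maps R M N"
    and u: "u \<in> carrier (tensor_free M A)"
  shows "tensor_map R M N A f (tensor_rels R M A #>\<^bsub>tensor_free M A\<^esub> u) =
    tensor_rels R N A #>\<^bsub>tensor_free N A\<^esub> frag_extend (\<lambda>(x, a). frag_of (f x, a)) u"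
    (is "_ = ?K #>\<^bsub>?F\<^esub> ?e u")
proof -
  have "?K #>\<^bsub>?F\<^esub> ?e v = ?K #>\<^bsub>?F\<^esub> ?e u"
    if "v \<in> tensor_rels R M A #>\<^bsub>tensor_free M A\<^esub> u" for v
  proof -
    from that obtain k where k: "k \<in> tensor_rels R M A" "v = k + u"
      unfolding r_coset_def by auto
    then have "v \<in> carrier (tensor_free M A)"
      using tensor_rels_keys[OF M A] u keys_add[of k u] by fastforce
    moreover have "?e v - ?e u \<in> ?K"
      using tensor_map_rels[OF M N A f k(1)] by (simp add: k frag_extend_add)
    ultimately show ?thesis
      using tensor_coset_eq_iff[OF N A] tensor_map_closed[OF f] u by blast
  qed
  moreover have "u \<in> tensor_rels R M A #>\<^bsub>tensor_free M A\<^esub> u"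
    using group.rcos_self[OF _ u subgroup_tensor_rels[OF M A]] by simp
  ultimately show ?thesis
    unfolding tensor_map_def by blast
qed

lemma inj_tensor_map_iff:
  assumes M: "module R M" and N: "module R N" and A: "module R A" and f: "f \<in> linear_maps R M N"
  shows "inj_on (tensor_map R M N A f) (carrier (tensor R M A)) \<longleftrightarrow>
    (\<forall>u \<in> carrier (tensor_free M A).
       frag_extend (\<lambda>(x, a). frag_of (f x, a)) u \<in> tensor_rels R N A \<longrightarrow> u \<in> tensor_rels R M A)"
    (is "?L \<longleftrightarrow> ?R")
proof -
  let ?e = "frag_extend (\<lambda>(x, a). frag_of (f x, a))" and ?F = "tensor_free M A"
  have car: "carrier (tensor R M A) = (\<lambda>u. tensor_rels R M A #>\<^bsub>?F\<^esub> u) ` carrier ?F"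
    unfolding tensor_def FactGroup_def RCOSETS_def by auto
  have eq: "tensor_map R M N A f (tensor_rels R M A #>\<^bsub>?F\<^esub> u)
      = tensor_map R M N A f (tensor_rels R M A #>\<^bsub>?F\<^esub> v) \<longleftrightarrow> ?e (u - v) \<in> tensor_rels R N A"
    if "u \<in> carrier ?F" "v \<in> carrier ?F" for u v
    using that tensor_coset_eq_iff[OF N A tensor_map_closed[OF f] tensor_map_closed[OF f]]
    by (simp add: tensor_map_coset[OF M N A f] frag_extend_diff del: carrier_free_Abelian_group_iff)
  have sub: "u - v \<in> carrier ?F" if "u \<in> carrier ?F" "v \<in> carrier ?F" for u v
    using that keys_diff[of u v] by fastforce
  have "?L \<longleftrightarrow> (\<forall>u \<in> carrier ?F. \<forall>v \<in> carrier ?F.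
      ?e (u - v) \<in> tensor_rels R N A \<longrightarrow> u - v \<in> tensor_rels R M A)"
    unfolding inj_on_def car
    using eq tensor_coset_eq_iff[OF M A] by (simp del: carrier_free_Abelian_group_iff)
  also have "\<dots> \<longleftrightarrow> ?R"
  proof
    assume "\<forall>u \<in> carrier ?F. \<forall>v \<in> carrier ?F.
      ?e (u - v) \<in> tensor_rels R N A \<longrightarrow> u - v \<in> tensor_rels R M A"
    moreover have "0 \<in> carrier ?F" by simp
    ultimately show ?R by (metis diff_zero)
  qed (use sub in blast)
  finally show ?thesis .
qed

lemma tensor_rels_bilinear:
  fixes b :: "'u \<Rightarrow> 's \<Rightarrow> 'g"
  assumes M: "module R M" and A: "module R A" and G: "comm_group G"
    and cl: "\<And>x a. x \<in> carrier M \<Longrightarrow> a \<in> carrier A \<Longrightarrow> b x a \<in> carrier G"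
    and l: "\<And>x y a. x \<in> carrier M \<Longrightarrow> y \<in> carrier M \<Longrightarrow> a \<in> carrier A \<Longrightarrow>
      b (x \<oplus>\<^bsub>M\<^esub> y) a = b x a \<otimes>\<^bsub>G\<^esub> b y a"
    and r: "\<And>x a a'. x \<in> carrier M \<Longrightarrow> a \<in> carrier A \<Longrightarrow> a' \<in> carrier A \<Longrightarrow>
      b x (a \<oplus>\<^bsub>A\<^esub> a') = b x a \<otimes>\<^bsub>G\<^esub> b x a'"
    and s: "\<And>c x a. c \<in> carrier R \<Longrightarrow> x \<in> carrier M \<Longrightarrow> a \<in> carrier A \<Longrightarrow>
      b (c \<odot>\<^bsub>M\<^esub> x) a = b x (c \<odot>\<^bsub>A\<^esub> a)"
    and u: "frag_of (x, a) \<in> tensor_rels R M A"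
  shows "b x a = \<one>\<^bsub>G\<^esub>"
proof -
  interpret G: comm_group G by fact
  interpret M: module R M by fact
  interpret A: module R A by fact
  let ?F = "tensor_free M A"
  obtain h where h: "h \<in> hom ?F G" "\<And>p. p \<in> carrier M \<times> carrier A \<Longrightarrow> h (frag_of p) = case_prod b p"
    by (rule G.free_Abelian_group_universal[of "case_prod b" "carrier M \<times> carrier A"]) (use cl in auto)
  interpret h: group_hom ?F G h
    using h(1) by (simp add: group_hom_def group_hom_axioms_def G.is_group)
  have hd: "h (u - v) = h u \<otimes>\<^bsub>G\<^esub> inv\<^bsub>G\<^esub> h v" if "u \<in> carrier ?F" "v \<in> carrier ?F" for u v
  proof -
    have "u - v = u \<otimes>\<^bsub>?F\<^esub> inv\<^bsub>?F\<^esub> v" using that by simp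
    then show ?thesis using that by (simp only: h.hom_mult h.hom_inv group.inv_closed[OF group_free_Abelian_group])
  qed
  have dcl: "u - v \<in> carrier ?F" if "u \<in> carrier ?F" "v \<in> carrier ?F" for u v
    using that keys_diff[of u v] by fastforce
  have c: "(p \<otimes>\<^bsub>G\<^esub> q) \<otimes>\<^bsub>G\<^esub> inv\<^bsub>G\<^esub> p \<otimes>\<^bsub>G\<^esub> inv\<^bsub>G\<^esub> q = \<one>\<^bsub>G\<^esub>"
    if "p \<in> carrier G" "q \<in> carrier G" for p q
  proof -
    have "(p \<otimes>\<^bsub>G\<^esub> q) \<otimes>\<^bsub>G\<^esub> inv\<^bsub>G\<^esub> p \<otimes>\<^bsub>G\<^esub> inv\<^bsub>G\<^esub> q = (p \<otimes>\<^bsub>G\<^esub> inv\<^bsub>G\<^esub> p) \<otimes>\<^bsub>G\<^esub> (q \<otimes>\<^bsub>G\<^esub> inv\<^bsub>G\<^esub> q)"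
      using that by (simp only: G.m_ac G.m_closed G.inv_closed)
    then show ?thesis using that by simp
  qed
  have g: "h u = \<one>\<^bsub>G\<^esub>" if "u \<in> tensor_gens R M A" for u
    using that unfolding tensor_gens_def
  proof (elim UnE CollectE exE conjE)
    fix x y a assume *: "u = frag_of (x \<oplus>\<^bsub>M\<^esub> y, a) - frag_of (x, a) - frag_of (y, a)"
      "x \<in> carrier M" "y \<in> carrier M" "a \<in> carrier A"
    have "h u = (b x a \<otimes>\<^bsub>G\<^esub> b y a) \<otimes>\<^bsub>G\<^esub> inv\<^bsub>G\<^esub> b x a \<otimes>\<^bsub>G\<^esub> inv\<^bsub>G\<^esub> b y a"
      using * by (simp add: hd dcl h(2) l del: carrier_free_Abelian_group_iff)
    then show ?thesis using c * cl by simp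
  next
    fix x a a' assume *: "u = frag_of (x, a \<oplus>\<^bsub>A\<^esub> a') - frag_of (x, a) - frag_of (x, a')"
      "x \<in> carrier M" "a \<in> carrier A" "a' \<in> carrier A"
    have "h u = (b x a \<otimes>\<^bsub>G\<^esub> b x a') \<otimes>\<^bsub>G\<^esub> inv\<^bsub>G\<^esub> b x a \<otimes>\<^bsub>G\<^esub> inv\<^bsub>G\<^esub> b x a'"
      using * by (simp add: hd dcl h(2) r del: carrier_free_Abelian_group_iff)
    then show ?thesis using c * cl by simp
  next
    fix c x a assume *: "u = frag_of (c \<odot>\<^bsub>M\<^esub> x, a) - frag_of (x, c \<odot>\<^bsub>A\<^esub> a)"
      "c \<in> carrier R" "x \<in> carrier M" "a \<in> carrier A"
    then show ?thesis
      using cl by (simp add: hd h(2) s del: carrier_free_Abelian_group_iff)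
  qed
  have k: "h u = \<one>\<^bsub>G\<^esub>" if "u \<in> tensor_rels R M A" for u
    using that unfolding tensor_rels_def
  proof (induction rule: generate.induct)
    case one show ?case by (rule h.hom_one)
  next
    case (incl u) then show ?case by (rule g)
  next
    case (inv u)
    then have "u \<in> carrier ?F" using tensor_gens_subset[OF M A] by blast
    then show ?case using g[OF inv] by (simp only: h.hom_inv G.inv_one)
  next
    case (eng u v)
    have "u \<in> carrier ?F" "v \<in> carrier ?F"
      using eng.hyps subgroup.subset[OF subgroup_tensor_rels[OF M A]] unfolding tensor_rels_def by blast+
    then show ?case using eng.IH by (simp only: h.hom_mult G.r_one G.one_closed)
  qed
  have "(x, a) \<in> carrier M \<times> carrier A"
    using tensor_rels_keys[OF M A u] by simp
  then show ?thesis using h(2)[of "(x, a)"] k[OF u] by simp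
qed


lemma frag_of_zero_left:
  assumes M: "module R M" and a: "a \<in> carrier A"
    and A: "module R A"
  shows "frag_of (\<zero>\<^bsub>M\<^esub>, a) \<in> tensor_rels R M A"
proof -
  interpret M: module R M by fact
  have "frag_of (\<zero>\<^bsub>M\<^esub> \<oplus>\<^bsub>M\<^esub> \<zero>\<^bsub>M\<^esub>, a) - frag_of (\<zero>\<^bsub>M\<^esub>, a) - frag_of (\<zero>\<^bsub>M\<^esub>, a) \<in> tensor_gens R M A"
    unfolding tensor_gens_def using a M.M.zero_closed by blast
  from tensor_rels_minus[OF M A tensor_gens_rels[OF this]] show ?thesis by simp
qed

lemma frag_of_zero_right:
  assumes M: "module R M" and x: "x \<in> carrier M" and A: "module R A"
  shows "frag_of (x, \<zero>\<^bsub>A\<^esub>) \<in> tensor_rels R M A"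
proof -
  interpret A: module R A by fact
  have "frag_of (x, \<zero>\<^bsub>A\<^esub> \<oplus>\<^bsub>A\<^esub> \<zero>\<^bsub>A\<^esub>) - frag_of (x, \<zero>\<^bsub>A\<^esub>) - frag_of (x, \<zero>\<^bsub>A\<^esub>) \<in> tensor_gens R M A"
    unfolding tensor_gens_def using x A.M.zero_closed by blast
  from tensor_rels_minus[OF M A tensor_gens_rels[OF this]] show ?thesis by simp
qed

lemma frag_of_smult:
  assumes "r \<in> carrier R" "x \<in> carrier M" "a \<in> carrier A"
  shows "frag_of (r \<odot>\<^bsub>M\<^esub> x, a) - frag_of (x, r \<odot>\<^bsub>A\<^esub> a) \<in> tensor_rels R M A"
  by (rule tensor_gens_rels) (use assms in \<open>auto simp: tensor_gens_def\<close>)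

lemma frag_of_minus:
  assumes M: "module R M" and "x \<in> carrier M" "y \<in> carrier M" "a \<in> carrier A"
  shows "frag_of (x, a) - frag_of (x \<ominus>\<^bsub>M\<^esub> y, a) - frag_of (y, a) \<in> tensor_rels R M A"
proof -
  interpret M: module R M by fact
  have "frag_of ((x \<ominus>\<^bsub>M\<^esub> y) \<oplus>\<^bsub>M\<^esub> y, a) - frag_of (x \<ominus>\<^bsub>M\<^esub> y, a) - frag_of (y, a) \<in> tensor_gens R M A"
    unfolding tensor_gens_def using assms(2-4) M.M.minus_closed by blast
  moreover have "(x \<ominus>\<^bsub>M\<^esub> y) \<oplus>\<^bsub>M\<^esub> y = x"
    using assms(2,3) by (simp add: a_minus_def M.M.a_assoc M.M.l_neg)
  ultimately show ?thesis by (auto intro: tensor_gens_rels)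
qed

lemma module_restrict_scalars:
  assumes R: "cring R" and S: "cring S" and h: "h \<in> ring_hom R S"
  shows "module R (restrict_scalars S h)"
proof -
  interpret R: cring R by fact
  interpret S: cring S by fact
  interpret h: ring_hom_ring R S h
    using h by (intro ring_hom_ringI2 R.ring_axioms S.ring_axioms)
  have "abelian_group (restrict_scalars S h)"
  proof (rule abelian_groupI)
    fix x assume "x \<in> carrier (restrict_scalars S h)"
    then show "\<exists>y \<in> carrier (restrict_scalars S h).
        y \<oplus>\<^bsub>restrict_scalars S h\<^esub> x = \<zero>\<^bsub>restrict_scalars S h\<^esub>"
      by (intro bexI[of _ "\<ominus>\<^bsub>S\<^esub> x"]) (simp_all add: restrict_scalars_def S.l_neg)
  qed (simp_all add: restrict_scalars_def S.a_ac)
  then show ?thesis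
    by (intro moduleI R)
      (simp_all add: restrict_scalars_def S.l_distr S.r_distr S.m_assoc)
qed

abbreviation quot_module :: "('a, 'x) ring_scheme \<Rightarrow> 'a set \<Rightarrow> ('a, 'a set) module" where
  "quot_module R I \<equiv> restrict_scalars (R Quot I) (\<lambda>r. I +>\<^bsub>R\<^esub> r)"

lemma module_quot_module:
  assumes "cring R" "ideal I R"
  shows "module R (quot_module R I)"
  using assms ideal.quotient_is_cring ideal.rcos_ring_hom by (blast intro: module_restrict_scalars)

lemma carrier_quot_module: "carrier (quot_module R I) = (\<lambda>s. I +>\<^bsub>R\<^esub> s) ` carrier R"
  unfolding restrict_scalars_def FactRing_def A_RCOSETS_def' by auto

lemma zero_quot_module: "\<zero>\<^bsub>quot_module R I\<^esub> = I"
  by (simp add: restrict_scalars_def FactRing_def)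

lemma add_quot_module:
  assumes "cring R" "ideal I R" "s \<in> carrier R" "t \<in> carrier R"
  shows "(I +>\<^bsub>R\<^esub> s) \<oplus>\<^bsub>quot_module R I\<^esub> (I +>\<^bsub>R\<^esub> t) = I +>\<^bsub>R\<^esub> (s \<oplus>\<^bsub>R\<^esub> t)"
  using ring_hom_add[OF ideal.rcos_ring_hom[OF assms(2)] assms(3,4)]
  by (simp add: restrict_scalars_def)

lemma smult_quot_module:
  assumes "cring R" "ideal I R" "s \<in> carrier R" "t \<in> carrier R"
  shows "s \<odot>\<^bsub>quot_module R I\<^esub> (I +>\<^bsub>R\<^esub> t) = I +>\<^bsub>R\<^esub> (s \<otimes>\<^bsub>R\<^esub> t)"
  using ring_hom_mult[OF ideal.rcos_ring_hom[OF assms(2)] assms(3,4)]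
  by (simp add: restrict_scalars_def)

lemma tensor_quot_zero:
  assumes R: "cring R" and I: "ideal I R" and N: "module R N" and T: "submodule T R N"
    and IN: "\<And>c n. c \<in> I \<Longrightarrow> n \<in> carrier N \<Longrightarrow> c \<odot>\<^bsub>N\<^esub> n \<in> T"
    and n: "n \<in> carrier N" and z: "frag_of (n, I +>\<^bsub>R\<^esub> \<one>\<^bsub>R\<^esub>) \<in> tensor_rels R N (quot_module R I)"
  shows "n \<in> T"
proof -
  interpret R: cring R by fact
  interpret N: module R N by fact
  interpret I: ideal I R by fact
  interpret T: submodule T R N by fact
  let ?N = "add_monoid N"
  let ?G = "?N Mod T"
  have aN: "comm_group ?N" by (rule N.a_comm_group)
  then have aNg: "group ?N" by (rule comm_group.axioms(2))
  have Tn: "normal T ?N"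
    by (rule comm_group.subgroup_imp_normal[OF aN T.subgroup_axioms])
  have G: "comm_group ?G"
    by (rule comm_group.abelian_FactGroup[OF aN T.subgroup_axioms])
  define b where "b \<equiv> \<lambda>x P. T #>\<^bsub>?N\<^esub> ((SOME s. s \<in> P) \<odot>\<^bsub>N\<^esub> x)"
  have absorb: "T #>\<^bsub>?N\<^esub> (t \<oplus>\<^bsub>N\<^esub> x) = T #>\<^bsub>?N\<^esub> x" if "t \<in> T" "x \<in> carrier N" for t x
  proof -
    have "t \<oplus>\<^bsub>N\<^esub> x \<in> T #>\<^bsub>?N\<^esub> x"
      using that(1) unfolding r_coset_def by (simp, blast)
    from group.repr_independence[OF aNg this _ T.subgroup_axioms] show ?thesis
      using that(2) by simp
  qed
  have b: "b x (I +>\<^bsub>R\<^esub> s) = T #>\<^bsub>?N\<^esub> (s \<odot>\<^bsub>N\<^esub> x)" if "x \<in> carrier N" "s \<in> carrier R" for x s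
  proof -
    have "(SOME t. t \<in> I +>\<^bsub>R\<^esub> s) \<in> I +>\<^bsub>R\<^esub> s"
      by (rule someI) (rule I.a_rcos_self[OF that(2)])
    then obtain i where i: "i \<in> I" "(SOME t. t \<in> I +>\<^bsub>R\<^esub> s) = i \<oplus>\<^bsub>R\<^esub> s"
      unfolding a_r_coset_def' by auto
    have "b x (I +>\<^bsub>R\<^esub> s) = T #>\<^bsub>?N\<^esub> (i \<odot>\<^bsub>N\<^esub> x \<oplus>\<^bsub>N\<^esub> s \<odot>\<^bsub>N\<^esub> x)"
      unfolding b_def i(2) using that i(1) I.a_subset by (simp add: N.smult_l_distr subset_iff)
    then show ?thesis using absorb IN i(1) that by simp
  qed
  have sum: "(T #>\<^bsub>?N\<^esub> x) <#>\<^bsub>?N\<^esub> (T #>\<^bsub>?N\<^esub> y) = T #>\<^bsub>?N\<^esub> (x \<oplus>\<^bsub>N\<^esub> y)"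
    if "x \<in> carrier N" "y \<in> carrier N" for x y
    using normal.rcos_sum[OF Tn, of x y] that by simp
  have cl: "T #>\<^bsub>?N\<^esub> x \<in> carrier ?G" if "x \<in> carrier N" for x
    using that by (auto simp: FactGroup_def RCOSETS_def)
  note simps = carrier_quot_module b sum cl N.smult_l_distr N.smult_r_distr N.smult_assoc1
    add_quot_module[OF R I] smult_quot_module[OF R I]
  have "b n (I +>\<^bsub>R\<^esub> \<one>\<^bsub>R\<^esub>) = \<one>\<^bsub>?G\<^esub>"
  proof (rule tensor_rels_bilinear[OF N module_quot_module[OF R I] G _ _ _ _ z])
    fix c x a assume "c \<in> carrier R" "x \<in> carrier N" "a \<in> carrier (quot_module R I)"
    then obtain s where s: "a = I +>\<^bsub>R\<^esub> s" "s \<in> carrier R" "c \<in> carrier R" "x \<in> carrier N"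
      by (auto simp: carrier_quot_module)
    then have "b (c \<odot>\<^bsub>N\<^esub> x) a = T #>\<^bsub>?N\<^esub> ((s \<otimes>\<^bsub>R\<^esub> c) \<odot>\<^bsub>N\<^esub> x)"
      by (simp add: simps)
    also have "s \<otimes>\<^bsub>R\<^esub> c = c \<otimes>\<^bsub>R\<^esub> s"
      using s by (simp add: R.m_comm)
    also have "T #>\<^bsub>?N\<^esub> ((c \<otimes>\<^bsub>R\<^esub> s) \<odot>\<^bsub>N\<^esub> x) = b x (c \<odot>\<^bsub>quot_module R I\<^esub> a)"
      using s by (simp add: simps del: N.smult_assoc1)
    finally show "b (c \<odot>\<^bsub>N\<^esub> x) a = b x (c \<odot>\<^bsub>quot_module R I\<^esub> a)" .
  qed (auto simp: simps)
  then have "T #>\<^bsub>?N\<^esub> n = T"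
    using n by (simp add: b FactGroup_def)
  then show "n \<in> T"
    using group.rcos_self[OF aNg, of n T] n T.subgroup_axioms by simp
qed

lemma pure_idealD_aux:
  fixes R :: "('a, 'x) ring_scheme"
  assumes R: "cring R" and I: "ideal I R"
    and flat: "flat_module TYPE('a) R (quot_module R I)" and a: "a \<in> I"
  shows "\<exists>b \<in> I. a \<otimes>\<^bsub>R\<^esub> (\<one>\<^bsub>R\<^esub> \<ominus>\<^bsub>R\<^esub> b) = \<zero>\<^bsub>R\<^esub>"
proof -
  interpret R: cring R by fact
  interpret I: ideal I R by fact
  have IR: "c \<in> carrier R" if "c \<in> I" for c using that I.a_subset by blast
  have aR: "a \<in> carrier R" using a by (rule IR)
  let ?A = "quot_module R I"
  define N where "N = restrict_scalars R (\<lambda>x. x)"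
  define M where "M = N\<lparr>carrier := PIdl\<^bsub>R\<^esub> a\<rparr>"
  have N: "module R N"
    unfolding N_def by (rule module_restrict_scalars) (auto simp: R intro: ring_hom_memI)
  interpret N: module R N by fact
  interpret P: ideal "PIdl\<^bsub>R\<^esub> a" R by (rule R.cgenideal_ideal[OF aR])
  have Ns [simp]: "carrier N = carrier R" "ring.add N = ring.add R" "ring.zero N = ring.zero R" "smult N = monoid.mult R"
    "a_inv N x = a_inv R x" for x
    by (simp_all add: N_def restrict_scalars_def a_inv_def m_inv_def)
  have sub: "submodule (PIdl\<^bsub>R\<^esub> a) R N"
    by (rule N.submoduleI) (use P.a_subset P.I_l_closed in auto)
  have M: "module R M"
    unfolding M_def by (rule submodule.submodule_is_module[OF sub N])
  interpret M: module R M by fact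
  have Ms [simp]: "carrier M = PIdl\<^bsub>R\<^esub> a" "ring.add M = ring.add R" "ring.zero M = ring.zero R" "smult M = monoid.mult R"
    by (simp_all add: M_def)
  have A: "module R ?A" by (rule module_quot_module[OF R I])
  have f: "(\<lambda>x. x) \<in> linear_maps R M N"
    using P.a_subset by (auto simp: linear_maps_def)
  have aP: "a \<in> PIdl\<^bsub>R\<^esub> a" by (rule R.cgenideal_self[OF aR])
  have oneA: "I +>\<^bsub>R\<^esub> \<one>\<^bsub>R\<^esub> \<in> carrier ?A" by (auto simp: carrier_quot_module)
  have "inj_on (tensor_map R M N ?A (\<lambda>x. x)) (carrier (tensor R M ?A))"
    using flat M N f unfolding flat_module_def by auto
  then have inj: "u \<in> tensor_rels R M ?A"
    if "u \<in> carrier (tensor_free M ?A)" "frag_extend (\<lambda>(x, a). frag_of (x, a)) u \<in> tensor_rels R N ?A" for u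
    using that unfolding inj_tensor_map_iff[OF M N A f] by blast
  have "frag_of (a \<odot>\<^bsub>N\<^esub> \<one>\<^bsub>R\<^esub>, I +>\<^bsub>R\<^esub> \<one>\<^bsub>R\<^esub>) - frag_of (\<one>\<^bsub>R\<^esub>, a \<odot>\<^bsub>?A\<^esub> (I +>\<^bsub>R\<^esub> \<one>\<^bsub>R\<^esub>)) \<in> tensor_rels R N ?A"
    by (rule frag_of_smult) (use aR oneA in auto)
  moreover have "a \<odot>\<^bsub>?A\<^esub> (I +>\<^bsub>R\<^esub> \<one>\<^bsub>R\<^esub>) = \<zero>\<^bsub>?A\<^esub>"
    using aR a by (simp add: smult_quot_module[OF R I] zero_quot_module I.a_rcos_const)
  moreover have "frag_of (\<one>\<^bsub>R\<^esub>, \<zero>\<^bsub>?A\<^esub>) \<in> tensor_rels R N ?A"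
    by (rule frag_of_zero_right[OF N _ A]) simp
  ultimately have "frag_of (a, I +>\<^bsub>R\<^esub> \<one>\<^bsub>R\<^esub>) \<in> tensor_rels R N ?A"
    using aR tensor_rels_add by (fastforce simp: algebra_simps)
  then have z: "frag_of (a, I +>\<^bsub>R\<^esub> \<one>\<^bsub>R\<^esub>) \<in> tensor_rels R M ?A"
    using aP oneA by (intro inj) auto
  let ?T = "(\<lambda>c. a \<otimes>\<^bsub>R\<^esub> c) ` I"
  have T: "submodule ?T R M"
  proof (rule M.submoduleI)
    show "?T \<subseteq> carrier M"
      using aP P.I_r_closed I.a_subset by auto
    show "\<zero>\<^bsub>M\<^esub> \<in> ?T"
      using aR by (intro image_eqI[of _ _ "\<zero>\<^bsub>R\<^esub>"]) simp_all
    show "x \<oplus>\<^bsub>M\<^esub> y \<in> ?T" if xy: "x \<in> ?T" "y \<in> ?T" for x y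
    proof -
      obtain c d where c: "c \<in> I" "x = a \<otimes>\<^bsub>R\<^esub> c" and d: "d \<in> I" "y = a \<otimes>\<^bsub>R\<^esub> d"
        using xy by blast
      then have "x \<oplus>\<^bsub>M\<^esub> y = a \<otimes>\<^bsub>R\<^esub> (c \<oplus>\<^bsub>R\<^esub> d)"
        using aR IR by (simp add: R.r_distr)
      then show ?thesis using c(1) d(1) by blast
    qed
    show smult: "r \<odot>\<^bsub>M\<^esub> x \<in> ?T" if rx: "r \<in> carrier R" "x \<in> ?T" for r x
    proof -
      obtain c where c: "c \<in> I" "x = a \<otimes>\<^bsub>R\<^esub> c" using rx(2) by blast
      then have "r \<odot>\<^bsub>M\<^esub> x = a \<otimes>\<^bsub>R\<^esub> (r \<otimes>\<^bsub>R\<^esub> c)"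
        using aR IR rx(1) by (simp add: R.m_lcomm)
      then show ?thesis using I.I_l_closed[OF c(1) rx(1)] by blast
    qed
    show "\<ominus>\<^bsub>M\<^esub> x \<in> ?T" if "x \<in> ?T" for x
    proof -
      have "x \<in> carrier M" using that aP P.I_r_closed I.a_subset by auto
      then have "\<ominus>\<^bsub>M\<^esub> x = (\<ominus>\<^bsub>R\<^esub> \<one>\<^bsub>R\<^esub>) \<odot>\<^bsub>M\<^esub> x"
        using M.smult_l_minus[of "\<one>\<^bsub>R\<^esub>" x] M.smult_one[of x] by (simp del: Ms)
      then show ?thesis using smult[OF _ that, of "\<ominus>\<^bsub>R\<^esub> \<one>\<^bsub>R\<^esub>"] by simp
    qed
  qed
  have IM: "c \<odot>\<^bsub>M\<^esub> n \<in> ?T" if c: "c \<in> I" and n: "n \<in> carrier M" for c n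
  proof -
    obtain r where r: "r \<in> carrier R" "n = r \<otimes>\<^bsub>R\<^esub> a"
      using n unfolding Ms cgenideal_def by blast
    have "c \<odot>\<^bsub>M\<^esub> n = a \<otimes>\<^bsub>R\<^esub> (c \<otimes>\<^bsub>R\<^esub> r)"
      using r IR[OF c] aR by (simp add: R.m_ac)
    then show ?thesis using I.I_r_closed[OF c r(1)] by blast
  qed
  have "a \<in> carrier M" using aP by simp
  from tensor_quot_zero[OF R I M T IM this z] have "a \<in> ?T" .
  then obtain b where b: "b \<in> I" "a = a \<otimes>\<^bsub>R\<^esub> b" by blast
  then have "a \<otimes>\<^bsub>R\<^esub> (\<one>\<^bsub>R\<^esub> \<ominus>\<^bsub>R\<^esub> b) = \<zero>\<^bsub>R\<^esub>"
    using aR IR[OF b(1)] by (simp add: a_minus_def R.r_distr R.r_minus R.r_neg flip: b(2))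
  then show ?thesis using b(1) by blast
qed

lemma flat_quot_module:
  fixes R :: "('a, 'x) ring_scheme"
  assumes R: "cring R" and I: "ideal I R"
    and pure: "\<forall>a \<in> I. \<exists>b \<in> I. a \<otimes>\<^bsub>R\<^esub> (\<one>\<^bsub>R\<^esub> \<ominus>\<^bsub>R\<^esub> b) = \<zero>\<^bsub>R\<^esub>"
  shows "flat_module TYPE('u) R (quot_module R I)"
  unfolding flat_module_def
proof (intro conjI allI impI module_quot_module[OF R I])
  fix M N :: "('a, 'u) module" and f
  assume "module R M \<and> module R N \<and> f \<in> linear_maps R M N \<and> inj_on f (carrier M)"
  then have M: "module R M" and N: "module R N" and f: "f \<in> linear_maps R M N"
    and inj: "inj_on f (carrier M)" by auto
  interpret R: cring R by fact
  interpret I: ideal I R by fact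
  interpret M: module R M by fact
  interpret N: module R N by fact
  let ?A = "quot_module R I" and ?one = "I +>\<^bsub>R\<^esub> \<one>\<^bsub>R\<^esub>"
  let ?e = "frag_extend (\<lambda>(x, a). frag_of (f x, a))"
  have A: "module R ?A" by (rule module_quot_module[OF R I])
  have IR: "c \<in> carrier R" if "c \<in> I" for c using that I.a_subset by blast
  have oneA: "?one \<in> carrier ?A" by (auto simp: carrier_quot_module)
  have red: "\<exists>m \<in> carrier M. u - frag_of (m, ?one) \<in> tensor_rels R M ?A"
    if "Poly_Mapping.keys u \<subseteq> carrier M \<times> carrier ?A" for u
    using that
  proof (rule free_Abelian_group_induct)
    show "\<exists>m \<in> carrier M. 0 - frag_of (m, ?one) \<in> tensor_rels R M ?A"
      using tensor_rels_minus[OF M A frag_of_zero_left[OF M oneA A]] by auto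
  next
    fix u v
    assume "\<exists>m \<in> carrier M. u - frag_of (m, ?one) \<in> tensor_rels R M ?A"
      "\<exists>m \<in> carrier M. v - frag_of (m, ?one) \<in> tensor_rels R M ?A"
    then obtain m n where m: "m \<in> carrier M" "u - frag_of (m, ?one) \<in> tensor_rels R M ?A"
      and n: "n \<in> carrier M" "v - frag_of (n, ?one) \<in> tensor_rels R M ?A" by blast
    have "(u - frag_of (m, ?one)) - (v - frag_of (n, ?one)) +
        (frag_of (m, ?one) - frag_of (m \<ominus>\<^bsub>M\<^esub> n, ?one) - frag_of (n, ?one)) \<in> tensor_rels R M ?A"
      by (intro tensor_rels_add tensor_rels_diff M A m n frag_of_minus oneA)
    then have "(u - v) - frag_of (m \<ominus>\<^bsub>M\<^esub> n, ?one) \<in> tensor_rels R M ?A"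
      by (simp add: algebra_simps)
    then show "\<exists>m \<in> carrier M. (u - v) - frag_of (m, ?one) \<in> tensor_rels R M ?A"
      using m n by blast
  next
    fix p assume "p \<in> carrier M \<times> carrier ?A"
    then obtain m s where p: "p = (m, I +>\<^bsub>R\<^esub> s)" "m \<in> carrier M" "s \<in> carrier R"
      by (auto simp: carrier_quot_module)
    have "frag_of (s \<odot>\<^bsub>M\<^esub> m, ?one) - frag_of (m, s \<odot>\<^bsub>?A\<^esub> ?one) \<in> tensor_rels R M ?A"
      by (rule frag_of_smult) (use p oneA in auto)
    from tensor_rels_minus[OF M A this] have "frag_of p - frag_of (s \<odot>\<^bsub>M\<^esub> m, ?one) \<in> tensor_rels R M ?A"
      using p by (simp add: smult_quot_module[OF R I])
    then show "\<exists>m \<in> carrier M. frag_of p - frag_of (m, ?one) \<in> tensor_rels R M ?A"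
      using p by blast
  qed
  let ?T = "{n \<in> carrier N. \<exists>c \<in> I. c \<odot>\<^bsub>N\<^esub> n = n}"
  have TI: "n \<in> ?T" if "c \<in> I" "c \<odot>\<^bsub>N\<^esub> n = n" "n \<in> carrier N" for c n
    by (intro CollectI conjI bexI[of _ c] that)
  have TE: thesis if "n \<in> ?T"
    "\<And>c. c \<in> I \<Longrightarrow> c \<odot>\<^bsub>N\<^esub> n = n \<Longrightarrow> n \<in> carrier N \<Longrightarrow> thesis" for n thesis
    using that(1) by (elim CollectE conjE bexE) (rule that(2))
  have T: "submodule ?T R N"
  proof (rule N.submoduleI)
    show "\<zero>\<^bsub>N\<^esub> \<in> ?T"
      using I.zero_closed N.smult_r_null[of "\<zero>\<^bsub>R\<^esub>"] R.zero_closed N.M.zero_closed by blast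
    show "\<ominus>\<^bsub>N\<^esub> x \<in> ?T" if h: "x \<in> ?T" for x
    proof -
      obtain c where c: "c \<in> I" "c \<odot>\<^bsub>N\<^esub> x = x" and x: "x \<in> carrier N" by (rule TE[OF h])
      have "c \<odot>\<^bsub>N\<^esub> (\<ominus>\<^bsub>N\<^esub> x) = \<ominus>\<^bsub>N\<^esub> x"
        using N.smult_r_minus[OF IR[OF c(1)] x] unfolding c(2) .
      then show ?thesis by (rule TI[OF c(1) _ N.M.a_inv_closed[OF x]])
    qed
    show "r \<odot>\<^bsub>N\<^esub> x \<in> ?T" if h: "r \<in> carrier R" "x \<in> ?T" for r x
    proof -
      obtain c where c: "c \<in> I" "c \<odot>\<^bsub>N\<^esub> x = x" and x: "x \<in> carrier N" by (rule TE[OF h(2)])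
      have "c \<odot>\<^bsub>N\<^esub> (r \<odot>\<^bsub>N\<^esub> x) = r \<odot>\<^bsub>N\<^esub> (c \<odot>\<^bsub>N\<^esub> x)"
        using h(1) x IR[OF c(1)] by (simp add: R.m_comm flip: N.smult_assoc1)
      then show ?thesis unfolding c(2) by (rule TI[OF c(1) _ N.smult_closed[OF h(1) x]])
    qed
    show "x \<oplus>\<^bsub>N\<^esub> y \<in> ?T" if h: "x \<in> ?T" "y \<in> ?T" for x y
    proof -
      obtain c where c: "c \<in> I" "c \<odot>\<^bsub>N\<^esub> x = x" and x: "x \<in> carrier N"
        by (rule TE[OF h(1)])
      obtain d where d: "d \<in> I" "d \<odot>\<^bsub>N\<^esub> y = y" and y: "y \<in> carrier N"
        by (rule TE[OF h(2)])
      have cR: "c \<in> carrier R" and dR: "d \<in> carrier R" using c d IR by auto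
      define e where "e = c \<oplus>\<^bsub>R\<^esub> (\<one>\<^bsub>R\<^esub> \<ominus>\<^bsub>R\<^esub> c) \<otimes>\<^bsub>R\<^esub> d"
      have e: "e \<in> I"
        unfolding e_def using c d cR by (intro I.a_closed I.I_l_closed) auto
      have x0: "(\<one>\<^bsub>R\<^esub> \<ominus>\<^bsub>R\<^esub> c) \<odot>\<^bsub>N\<^esub> x = \<zero>\<^bsub>N\<^esub>"
        using x c cR by (simp add: a_minus_def N.smult_l_distr N.smult_l_minus N.M.r_neg)
      have "e \<odot>\<^bsub>N\<^esub> x = c \<odot>\<^bsub>N\<^esub> x \<oplus>\<^bsub>N\<^esub> d \<odot>\<^bsub>N\<^esub> ((\<one>\<^bsub>R\<^esub> \<ominus>\<^bsub>R\<^esub> c) \<odot>\<^bsub>N\<^esub> x)"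
        unfolding e_def using x cR dR
        by (simp add: N.smult_l_distr R.m_comm[of _ d] flip: N.smult_assoc1)
      then have ex: "e \<odot>\<^bsub>N\<^esub> x = x"
        unfolding x0 using c x dR by simp
      have "e \<odot>\<^bsub>N\<^esub> y = c \<odot>\<^bsub>N\<^esub> y \<oplus>\<^bsub>N\<^esub> (\<one>\<^bsub>R\<^esub> \<ominus>\<^bsub>R\<^esub> c) \<odot>\<^bsub>N\<^esub> y"
        unfolding e_def using y cR dR d by (simp add: N.smult_l_distr N.smult_assoc1)
      also have "\<dots> = (c \<oplus>\<^bsub>R\<^esub> (\<one>\<^bsub>R\<^esub> \<ominus>\<^bsub>R\<^esub> c)) \<odot>\<^bsub>N\<^esub> y"
        using y cR by (simp add: N.smult_l_distr)
      also have "c \<oplus>\<^bsub>R\<^esub> (\<one>\<^bsub>R\<^esub> \<ominus>\<^bsub>R\<^esub> c) = \<one>\<^bsub>R\<^esub>"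
        using cR R.a_lcomm[of c "\<one>\<^bsub>R\<^esub>" "\<ominus>\<^bsub>R\<^esub> c"] by (simp add: a_minus_def R.r_neg)
      finally have "e \<odot>\<^bsub>N\<^esub> y = y" using y by simp
      with ex have "e \<odot>\<^bsub>N\<^esub> (x \<oplus>\<^bsub>N\<^esub> y) = x \<oplus>\<^bsub>N\<^esub> y"
        by (simp only: N.smult_r_distr[OF IR[OF e] x y])
      then show ?thesis by (rule TI[OF e _ N.M.a_closed[OF x y]])
    qed
  qed auto
  have IN: "c \<odot>\<^bsub>N\<^esub> n \<in> ?T" if c: "c \<in> I" and n: "n \<in> carrier N" for c n
  proof -
    obtain d where d: "d \<in> I" "c \<otimes>\<^bsub>R\<^esub> (\<one>\<^bsub>R\<^esub> \<ominus>\<^bsub>R\<^esub> d) = \<zero>\<^bsub>R\<^esub>" using pure c by blast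
    have "c = d \<otimes>\<^bsub>R\<^esub> c"
    proof -
      have "c \<ominus>\<^bsub>R\<^esub> d \<otimes>\<^bsub>R\<^esub> c = \<zero>\<^bsub>R\<^esub>"
        using d(2) IR[OF c] IR[OF d(1)]
        by (simp add: a_minus_def R.r_distr R.r_minus R.m_comm[of d])
      then show ?thesis using IR[OF c] IR[OF d(1)] by simp
    qed
    then have "d \<odot>\<^bsub>N\<^esub> (c \<odot>\<^bsub>N\<^esub> n) = c \<odot>\<^bsub>N\<^esub> n"
      using IR[OF c] IR[OF d(1)] n by (simp flip: N.smult_assoc1)
    then show ?thesis by (rule TI[OF d(1) _ N.smult_closed[OF IR[OF c] n]])
  qed
  show "inj_on (tensor_map R M N ?A f) (carrier (tensor R M ?A))"
    unfolding inj_tensor_map_iff[OF M N A f]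
  proof (intro ballI impI)
    fix u assume u: "u \<in> carrier (tensor_free M ?A)" and eu: "?e u \<in> tensor_rels R N ?A"
    obtain m where m: "m \<in> carrier M" "u - frag_of (m, ?one) \<in> tensor_rels R M ?A"
      using red u by auto
    have fm: "f m \<in> carrier N" using f m(1) by (auto simp: linear_maps_def)
    have "?e u - ?e (u - frag_of (m, ?one)) \<in> tensor_rels R N ?A"
      by (intro tensor_rels_diff N A eu tensor_map_rels[OF M N A f m(2)])
    then have "frag_of (f m, ?one) \<in> tensor_rels R N ?A"
      by (simp add: frag_extend_diff)
    from tensor_quot_zero[OF R I N T IN fm this] have "f m \<in> ?T" .
    then obtain c where c: "c \<in> I" "c \<odot>\<^bsub>N\<^esub> f m = f m"
      by (rule TE)
    have "f (c \<odot>\<^bsub>M\<^esub> m) = f m"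
      using f c IR m(1) by (auto simp: linear_maps_def)
    then have cm: "c \<odot>\<^bsub>M\<^esub> m = m"
      using inj m(1) IR[OF c(1)] by (auto dest: inj_onD)
    have "c \<odot>\<^bsub>?A\<^esub> ?one = \<zero>\<^bsub>?A\<^esub>"
      using IR[OF c(1)] c(1) by (simp add: smult_quot_module[OF R I] zero_quot_module I.a_rcos_const)
    then have "frag_of (m, ?one) - frag_of (m, \<zero>\<^bsub>?A\<^esub>) \<in> tensor_rels R M ?A"
      using frag_of_smult[of c R m M ?one ?A] IR[OF c(1)] m(1) oneA cm by simp
    from tensor_rels_add[OF tensor_rels_add[OF m(2) this] frag_of_zero_right[OF M m(1) A]]
    show "u \<in> tensor_rels R M ?A" by simp
  qed
qed

theorem pure_ideal_iff:
  fixes R :: "('a, 'x) ring_scheme"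
  assumes R: "cring R" and I: "ideal I R"
  shows "pure_ideal I R \<longleftrightarrow> (\<forall>a \<in> I. \<exists>b \<in> I. a \<otimes>\<^bsub>R\<^esub> (\<one>\<^bsub>R\<^esub> \<ominus>\<^bsub>R\<^esub> b) = \<zero>\<^bsub>R\<^esub>)"
  using pure_idealD_aux[OF R I] flat_quot_module[OF R I, where 'u = 'a] I ideal.rcos_ring_hom[OF I]
  unfolding pure_ideal_def flat_ring_hom_def by blast

theorem pure_ideal_flat:
  fixes R :: "('a, 'x) ring_scheme"
  assumes R: "cring R" and "pure_ideal I R"
  shows "flat_ring_hom TYPE('u) R (R Quot I) (\<lambda>r. I +>\<^bsub>R\<^esub> r)"
proof -
  have I: "ideal I R" using assms(2) unfolding pure_ideal_def by blast
  show ?thesis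
    using flat_quot_module[OF R I, where 'u = 'u] pure_ideal_iff[OF R I] assms(2)
      ideal.rcos_ring_hom[OF I]
    unfolding flat_ring_hom_def by blast
qed

end

theory Submission
  imports Defs
begin

text \<open>
  Both conditions say that the elements of \<open>m\<close> are killed by suitable elements. By
  \<open>pure_ideal_iff\<close>, purity of \<open>m\<close> asks that each \<open>a \<in> m\<close> be killed by some \<open>\<one> \<ominus> b\<close> with
  \<open>b \<in> m\<close>. The kernel of the localization at \<open>m\<close> consists of the elements killed by some
  \<open>s \<notin> m\<close> (\<open>a_kernel_localization_at\<close>); it always lies in \<open>m\<close>, because \<open>m\<close> is prime. So the
  claim is that an element is killed by some \<open>s \<notin> m\<close> exactly if it is killed by some element of
  the coset \<open>\<one> + m\<close>. The coset avoids \<open>m\<close>, since \<open>m\<close> is proper; and each \<open>s \<notin> m\<close> has a multiple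
  in the coset, since \<open>s\<close> is invertible modulo \<open>m\<close> (\<open>maximalideal_complement\<close>).
\<close>

text \<open>If \<open>u\<close> kills \<open>a\<close>, then multiplying a witness by \<open>u\<close> turns a relation of \<open>(a, \<one>)\<close> to
  some pair into a relation of \<open>(\<zero>, \<one>)\<close> to the same pair, and conversely. So the two classes
  have the same members, without an appeal to \<open>loc_rel\<close> being an equivalence relation.\<close>

lemma loc_frac_eq_zero_iff:
  fixes R (structure)
  assumes R: "cring R" and S: "submonoid S R" and a: "a \<in> carrier R"
  shows "loc_frac R S a \<one> = loc_frac R S \<zero> \<one> \<longleftrightarrow> (\<exists>u \<in> S. u \<otimes> a = \<zero>)"
proof -
  interpret cring R by fact
  interpret S: submonoid S R by fact
  have SR: "u \<in> carrier R" if "u \<in> S" for u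
    using that S.subset by blast
  have frac: "loc_frac R S c \<one> =
      {(b, t). b \<in> carrier R \<and> t \<in> S \<and> (\<exists>u \<in> S. u \<otimes> (c \<otimes> t \<ominus> b) = \<zero>)}"
    if "c \<in> carrier R" for c
    using that S.one_closed by (auto simp: loc_frac_def loc_rel_def)
  show ?thesis
  proof
    assume eq: "loc_frac R S a \<one> = loc_frac R S \<zero> \<one>"
    have "(\<zero>, \<one>) \<in> loc_frac R S \<zero> \<one>"
      unfolding frac[OF zero_closed] by (auto simp: a_minus_def intro: S.one_closed)
    then have "(\<zero>, \<one>) \<in> loc_frac R S a \<one>"
      unfolding eq .
    then show "\<exists>u \<in> S. u \<otimes> a = \<zero>"
      unfolding frac[OF a] using a by (auto simp: a_minus_def)
  next
    assume "\<exists>u \<in> S. u \<otimes> a = \<zero>"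
    then obtain u where u: "u \<in> S" "u \<otimes> a = \<zero>" by blast
    have *: "(u \<otimes> v) \<otimes> (a \<otimes> t \<ominus> b) = (u \<otimes> v) \<otimes> (\<zero> \<otimes> t \<ominus> b)"
      if "v \<in> S" "t \<in> S" "b \<in> carrier R" for v t b
    proof -
      have "(u \<otimes> v) \<otimes> (a \<otimes> t) = (u \<otimes> a) \<otimes> (v \<otimes> t)"
        using a that SR u(1) by (simp add: m_ac)
      then have "(u \<otimes> v) \<otimes> (a \<otimes> t) = \<zero>"
        using that SR by (simp add: u(2))
      then show ?thesis
        using a that SR u(1) by (simp add: a_minus_def r_distr)
    qed
    have scale: "(u \<otimes> v) \<otimes> x = \<zero>" if "v \<in> S" "x \<in> carrier R" "v \<otimes> x = \<zero>" for v x
      using that SR u(1) by (simp add: m_assoc)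
    have "(\<exists>v \<in> S. v \<otimes> (a \<otimes> t \<ominus> b) = \<zero>) \<longleftrightarrow> (\<exists>v \<in> S. v \<otimes> (\<zero> \<otimes> t \<ominus> b) = \<zero>)"
      if t: "t \<in> S" and b: "b \<in> carrier R" for t b
    proof
      assume "\<exists>v \<in> S. v \<otimes> (a \<otimes> t \<ominus> b) = \<zero>"
      then obtain v where v: "v \<in> S" "v \<otimes> (a \<otimes> t \<ominus> b) = \<zero>" by blast
      have "(u \<otimes> v) \<otimes> (a \<otimes> t \<ominus> b) = \<zero>"
        by (rule scale) (use v a b SR[OF t] in auto)
      then show "\<exists>v \<in> S. v \<otimes> (\<zero> \<otimes> t \<ominus> b) = \<zero>"
        using *[OF v(1) t b] S.m_closed[OF u(1) v(1)] by auto
    next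
      assume "\<exists>v \<in> S. v \<otimes> (\<zero> \<otimes> t \<ominus> b) = \<zero>"
      then obtain v where v: "v \<in> S" "v \<otimes> (\<zero> \<otimes> t \<ominus> b) = \<zero>" by blast
      have "(u \<otimes> v) \<otimes> (\<zero> \<otimes> t \<ominus> b) = \<zero>"
        by (rule scale) (use v b SR[OF t] in auto)
      then show "\<exists>v \<in> S. v \<otimes> (a \<otimes> t \<ominus> b) = \<zero>"
        using *[OF v(1) t b] S.m_closed[OF u(1) v(1)] by auto
    qed
    then show "loc_frac R S a \<one> = loc_frac R S \<zero> \<one>"
      unfolding frac[OF a] frac[OF zero_closed] by blast
  qed
qed

lemma (in primeideal) submonoid_complement: "submonoid (carrier R - I) R"
proof
  show "x \<otimes> y \<in> carrier R - I" if "x \<in> carrier R - I" "y \<in> carrier R - I" for x y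
    using that I_prime by blast
  show "\<one> \<in> carrier R - I"
    using one_imp_carrier I_notcarr by blast
qed auto

lemma a_kernel_localization_at:
  fixes R (structure)
  assumes "cring R" and "primeideal p R"
  shows "a_kernel R (localization_at R p) (localization_map R p) =
    {a \<in> carrier R. \<exists>s \<in> carrier R - p. s \<otimes> a = \<zero>}"
  using loc_frac_eq_zero_iff[OF assms(1) primeideal.submonoid_complement[OF assms(2)]]
  by (auto simp: a_kernel_def' localization_at_def localization_def localization_map_def)

text \<open>The ideal \<open>I + (s)\<close> strictly contains \<open>I\<close>, so it is the whole ring and \<open>\<one>\<close> splits as an
  element of \<open>I\<close> plus a multiple of \<open>s\<close>.\<close>

lemma maximalideal_complement:
  fixes R (structure)
  assumes R: "cring R" and I: "maximalideal I R" and s: "s \<in> carrier R" "s \<notin> I"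
  obtains r b where "r \<in> carrier R" "b \<in> I" "r \<otimes> s = \<one> \<ominus> b"
proof -
  interpret cring R by fact
  interpret I: maximalideal I R by fact
  let ?J = "I <+>\<^bsub>R\<^esub> (PIdl s)"
  have P: "ideal (PIdl s) R" using s(1) by (rule cgenideal_ideal)
  interpret P: ideal "PIdl s" R by fact
  have J: "ideal ?J R" by (rule add_ideals[OF I.ideal_axioms P])
  have IJ: "I \<subseteq> ?J"
  proof
    fix x assume x: "x \<in> I"
    then have "x = x \<oplus> \<zero>" using I.a_subset by auto
    then show "x \<in> ?J" using x P.zero_closed unfolding set_add_def' by blast
  qed
  have "s \<in> ?J"
  proof -
    have "s = \<zero> \<oplus> s" using s(1) by simp
    then show ?thesis
      using I.zero_closed cgenideal_self[OF s(1)] unfolding set_add_def' by blast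
  qed
  moreover have "?J = I \<or> ?J = carrier R"
    using I.I_maximal[OF J IJ] ideal.Icarr[OF J] by blast
  ultimately have "\<one> \<in> ?J" using s(2) by auto
  then obtain b r where br: "b \<in> I" "r \<in> carrier R" "\<one> = b \<oplus> r \<otimes> s"
    unfolding set_add_def' cgenideal_def by blast
  have "b \<in> carrier R" using br(1) I.a_subset by blast
  then have "r \<otimes> s = \<one> \<ominus> b"
    unfolding br(3) using br(2) s(1) by algebra
  with br show thesis using that by blast
qed

theorem proposition3p14:
  fixes R :: "('a, 'x) ring_scheme" (structure) and m :: "'a set"
  assumes "gelfand_ring R" and "maximalideal m R"
  shows "pure_ideal m R \<longleftrightarrow>
    a_kernel R (localization_at R m) (localization_map R m) = m"
proof -
  interpret gelfand_ring R by fact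
  interpret m: maximalideal m R by fact
  interpret p: primeideal m R by (rule maximalideal_prime[OF assms(2)])
  let ?K = "{a \<in> carrier R. \<exists>s \<in> carrier R - m. s \<otimes> a = \<zero>}"
  have "?K \<subseteq> m"
  proof
    fix a assume "a \<in> ?K"
    then obtain s where s: "a \<in> carrier R" "s \<in> carrier R" "s \<notin> m" "s \<otimes> a = \<zero>" by blast
    have "s \<otimes> a \<in> m" unfolding s(4) by (rule m.zero_closed)
    then show "a \<in> m" using p.I_prime[OF s(2,1)] s(3) by blast
  qed
  moreover have "(\<exists>s \<in> carrier R - m. s \<otimes> a = \<zero>) \<longleftrightarrow> (\<exists>b \<in> m. a \<otimes> (\<one> \<ominus> b) = \<zero>)"
    if a: "a \<in> carrier R" for a
  proof
    assume "\<exists>s \<in> carrier R - m. s \<otimes> a = \<zero>"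
    then obtain s where s: "s \<in> carrier R" "s \<notin> m" "s \<otimes> a = \<zero>" by blast
    obtain r b where rb: "r \<in> carrier R" "b \<in> m" "r \<otimes> s = \<one> \<ominus> b"
      by (rule maximalideal_complement[OF is_cring assms(2) s(1,2)])
    have "a \<otimes> (r \<otimes> s) = r \<otimes> (s \<otimes> a)"
      using a s(1) rb(1) by (simp add: m_ac)
    then have "a \<otimes> (\<one> \<ominus> b) = \<zero>"
      using rb(1) by (simp add: s(3) rb(3))
    then show "\<exists>b \<in> m. a \<otimes> (\<one> \<ominus> b) = \<zero>" using rb(2) by blast
  next
    assume "\<exists>b \<in> m. a \<otimes> (\<one> \<ominus> b) = \<zero>"
    then obtain b where b: "b \<in> m" "a \<otimes> (\<one> \<ominus> b) = \<zero>" by blast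
    have bR: "b \<in> carrier R" using b(1) m.a_subset by blast
    have "\<one> \<ominus> b \<notin> m"
    proof
      assume "\<one> \<ominus> b \<in> m"
      then have "(\<one> \<ominus> b) \<oplus> b \<in> m" using b(1) by (rule m.a_closed)
      moreover have "(\<one> \<ominus> b) \<oplus> b = \<one>" using bR by algebra
      ultimately show False using m.one_imp_carrier m.I_notcarr by auto
    qed
    then show "\<exists>s \<in> carrier R - m. s \<otimes> a = \<zero>"
      using a bR b(2) by (intro bexI[of _ "\<one> \<ominus> b"]) (auto simp: m_comm)
  qed
  ultimately have "?K = m \<longleftrightarrow> (\<forall>a \<in> m. \<exists>b \<in> m. a \<otimes> (\<one> \<ominus> b) = \<zero>)"
    using m.a_subset by blast
  then show ?thesis
    using pure_ideal_iff[OF is_cring m.ideal_axioms]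
      a_kernel_localization_at[OF is_cring p.primeideal_axioms] by simp
qed

end
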